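(* Let $G$ be an ordered graph with at least one edge. Then $ssat_{<}(n,G)=O(1)$ if and only if all of the following hold: (1) $G$ contains a minedge; (2) $G$ contains an edge connecting the first vertex of $G$ with a vertex of degree one; (3) $G$ contains an edge connecting the last vertex of $G$ with a vertex of degree one. Otherwise $ssat_{<}(n,G)=\Theta(n)$.
   Context: An ordered graph is a finite simple graph whose vertex set is linearly ordered (identified with $[m]$ with the natural order). A copy of $G$ in an ordered graph $H$ is given by an injective order-preserving map $\varphi:V(G)\to V(H)$ with $\varphi(u)\varphi(v)\in E(H)$ for all $uv\in E(G)$. $H$ semisaturates $G$ if for every pair of distinct non-adjacent vertices $x,y$ of $H$, the graph $H+xy$ contains a copy of $G$ that is not contained in $H$ (i.e., a new copy, using the edge $xy$). $ssat_{<}(n,G)$ is the minimum number of edges of an ordered graph on $n$ vertices semisaturating $G$. Edges are written $uv$ with $u<v$; an edge $uv$ of $G$ is a minedge if no vertex lies strictly between $u$ and $v$ and both $u$ and $v$ have degree one. *)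

theory Defs
  imports Complex_Main "HOL-Library.Landau_Symbols"
begin

(* An ordered graph on the vertex set {1..n} is given by n and its edge set. An edge joining
   u and v with u < v is the pair (u, v); this loses nothing, since the graphs are simple. *)
definition ordered_graph :: "nat \<Rightarrow> (nat \<times> nat) set \<Rightarrow> bool" where
  "ordered_graph n E \<longleftrightarrow> E \<subseteq> {(u, v). u \<in> {1..n} \<and> v \<in> {1..n} \<and> u < v}"

definition degree :: "(nat \<times> nat) set \<Rightarrow> nat \<Rightarrow> nat" where
  "degree E v = card {e \<in> E. fst e = v \<or> snd e = v}"

definition is_copy ::
  "nat \<Rightarrow> (nat \<times> nat) set \<Rightarrow> nat \<Rightarrow> (nat \<times> nat) set \<Rightarrow> (nat \<Rightarrow> nat) \<Rightarrow> bool" where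
  "is_copy m G n H \<phi> \<longleftrightarrow>
     \<phi> ` {1..m} \<subseteq> {1..n} \<and> strict_mono_on {1..m} \<phi> \<and> (\<forall>(u, v)\<in>G. (\<phi> u, \<phi> v) \<in> H)"

definition semisaturates ::
  "nat \<Rightarrow> (nat \<times> nat) set \<Rightarrow> nat \<Rightarrow> (nat \<times> nat) set \<Rightarrow> bool" where
  "semisaturates n H m G \<longleftrightarrow>
     (\<forall>x\<in>{1..n}. \<forall>y\<in>{1..n}. x < y \<and> (x, y) \<notin> H \<longrightarrow>
        (\<exists>\<phi>. is_copy m G n (insert (x, y) H) \<phi> \<and> \<not> is_copy m G n H \<phi>))"

(* The minimum exists for every n, because the complete graph semisaturates vacuously. *)
definition ssat :: "nat \<Rightarrow> nat \<Rightarrow> (nat \<times> nat) set \<Rightarrow> nat" where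
  "ssat n m G = (LEAST k. \<exists>H. ordered_graph n H \<and> semisaturates n H m G \<and> card H = k)"

definition minedge :: "nat \<Rightarrow> (nat \<times> nat) set \<Rightarrow> nat \<times> nat \<Rightarrow> bool" where
  "minedge m G e \<longleftrightarrow>
     e \<in> G \<and> \<not> (\<exists>w\<in>{1..m}. fst e < w \<and> w < snd e) \<and> degree G (fst e) = 1 \<and> degree G (snd e) = 1"

lemma ssat_attained:
  "\<exists>H. ordered_graph n H \<and> semisaturates n H m G \<and> card H = ssat n m G"
proof -
  let ?K = "{(u, v). u \<in> {1..n} \<and> v \<in> {1..n} \<and> u < v}"
  have "ordered_graph n ?K \<and> semisaturates n ?K m G \<and> card ?K = card ?K"
    unfolding ordered_graph_def semisaturates_def by auto
  then have "\<exists>k H. ordered_graph n H \<and> semisaturates n H m G \<and> card H = k"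
    by blast
  then show ?thesis
    unfolding ssat_def by (rule LeastI_ex)
qed

end

theory Submission imports Defs begin

text \<open>
  Lower bound: the new edge of a new copy is the image of an edge \<open>uv\<close> of \<open>G\<close>, and an endpoint
  of \<open>uv\<close> whose degree is not one forces an old edge at its image. New edges at vertex \<open>1\<close> can
  only come from edges of \<open>G\<close> at its first vertex, new edges \<open>x (x+1)\<close> only from edges joining
  consecutive vertices. So if one of the conditions fails, a positive proportion of the
  vertices of a semisaturating graph is non-isolated.

  Upper bounds: joining the first and the last \<open>m\<close> vertices to everything and adding all edges
  of length at most \<open>m\<close> semisaturates \<open>G\<close>, since a shortest edge of \<open>G\<close> can be sent to any
  missing edge. Under the three conditions a clique on the first and the last \<open>2 m\<close> vertices
  suffices: a missing edge is the image of the minedge, unless one of its ends is so close to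
  an end of the clique that there is no room for the remaining vertices; then it is the image
  of the edge of \<open>G\<close> at the first or the last vertex.
\<close>

section \<open>Degrees and non-isolated vertices\<close>

lemma degree_one_unique:
  assumes "degree G w = 1" "e \<in> G" "e' \<in> G" "fst e = w \<or> snd e = w" "fst e' = w \<or> snd e' = w"
  shows "e = e'"
proof -
  obtain d where "{e \<in> G. fst e = w \<or> snd e = w} = {d}"
    using assms(1) unfolding degree_def by (rule card_1_singletonE)
  moreover have "e \<in> {e \<in> G. fst e = w \<or> snd e = w}" "e' \<in> {e \<in> G. fst e = w \<or> snd e = w}"
    using assms by auto
  ultimately show ?thesis by simp
qed

lemma degree_neq_one_other_edge:
  assumes "degree G w \<noteq> 1" "e \<in> G" "fst e = w \<or> snd e = w"
  obtains e' where "e' \<in> G" "e' \<noteq> e" "fst e' = w \<or> snd e' = w"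
proof -
  have "{e \<in> G. fst e = w \<or> snd e = w} \<noteq> {e}"
    using assms(1) unfolding degree_def by auto
  then show ?thesis using assms(2,3) that by blast
qed

lemma ordered_graphD:
  assumes "ordered_graph n E" "(u, v) \<in> E"
  shows "1 \<le> u" "u < v" "v \<le> n"
  using assms unfolding ordered_graph_def by auto

lemma ordered_graph_finite: "ordered_graph n E \<Longrightarrow> finite E"
  unfolding ordered_graph_def
  by (rule finite_subset[of _ "{1..n} \<times> {1..n}"]) auto

text \<open>These are the non-isolated vertices of \<open>H\<close>. The lower bound counts them, as
  each edge accounts for at most two.\<close>

definition endpoints :: "(nat \<times> nat) set \<Rightarrow> nat set" where
  "endpoints H = fst ` H \<union> snd ` H"

lemma endpointsI: "(u, v) \<in> H \<Longrightarrow> u \<in> endpoints H" "(u, v) \<in> H \<Longrightarrow> v \<in> endpoints H"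
  unfolding endpoints_def by force+

lemma card_endpoints_le:
  assumes "finite H"
  shows "card (endpoints H) \<le> 2 * card H"
proof -
  have "card (endpoints H) \<le> card (fst ` H) + card (snd ` H)"
    unfolding endpoints_def by (rule card_Un_le)
  also have "\<dots> \<le> 2 * card H"
    using card_image_le[OF assms, of fst] card_image_le[OF assms, of snd] by simp
  finally show ?thesis .
qed

section \<open>New copies and the edges of \<open>G\<close> sent to the new edge\<close>

lemma is_copy_less:
  assumes "is_copy m G n H \<phi>" "i \<in> {1..m}" "j \<in> {1..m}" "i < j"
  shows "\<phi> i < \<phi> j"
  using assms unfolding is_copy_def strict_mono_on_def by blast

lemma is_copy_inj: "is_copy m G n H \<phi> \<Longrightarrow> inj_on \<phi> {1..m}"
  unfolding is_copy_def by (blast intro: strict_mono_on_imp_inj_on)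

lemma is_copy_in: "is_copy m G n H \<phi> \<Longrightarrow> i \<in> {1..m} \<Longrightarrow> \<phi> i \<in> {1..n}"
  unfolding is_copy_def by blast

text \<open>If \<open>u\<close> or \<open>v\<close> has degree other than one, it lies on a second
  edge of \<open>G\<close>. By injectivity the image of that edge differs from
  \<open>(x, y)\<close>, so it is an edge of \<open>H\<close> at \<open>x\<close> or
  \<open>y\<close> respectively.\<close>

lemma new_copy_edge:
  assumes G: "ordered_graph m G"
    and new: "is_copy m G n (insert (x, y) H) \<phi>" "\<not> is_copy m G n H \<phi>"
  obtains u v where "(u, v) \<in> G" "\<phi> u = x" "\<phi> v = y"
    "degree G u = 1 \<or> x \<in> endpoints H" "degree G v = 1 \<or> y \<in> endpoints H"
proof -
  obtain u v where uv: "(u, v) \<in> G" "\<phi> u = x" "\<phi> v = y"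
    using new by (auto simp: is_copy_def)
  have other: "\<phi> w \<in> endpoints H" if w: "degree G w \<noteq> 1" "w = u \<or> w = v" for w
  proof -
    have "fst (u, v) = w \<or> snd (u, v) = w" using w(2) by auto
    then obtain e where e: "e \<in> G" "e \<noteq> (u, v)" "fst e = w \<or> snd e = w"
      by (rule degree_neq_one_other_edge[OF w(1) uv(1)])
    obtain s t where "e = (s, t)" by (rule prod.exhaust)
    then have st: "(s, t) \<in> G" "(s, t) \<noteq> (u, v)" "s = w \<or> t = w"
      using e by simp_all
    have "u \<in> {1..m}" "v \<in> {1..m}" "s \<in> {1..m}" "t \<in> {1..m}"
      using ordered_graphD[OF G uv(1)] ordered_graphD[OF G st(1)] by auto
    then have "\<phi> s = \<phi> u \<longleftrightarrow> s = u" "\<phi> t = \<phi> v \<longleftrightarrow> t = v"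
      using inj_on_eq_iff[OF is_copy_inj[OF new(1)]] by blast+
    then have "(\<phi> s, \<phi> t) \<noteq> (x, y)"
      using st(2) by (simp flip: uv(2,3))
    moreover have "(\<phi> s, \<phi> t) \<in> insert (x, y) H"
      using new(1) st(1) unfolding is_copy_def by fast
    ultimately show ?thesis using st(3) endpointsI by blast
  qed
  show ?thesis using that uv other by blast
qed

lemma semisaturates_edge:
  assumes "ordered_graph m G" "semisaturates n H m G"
    and "x \<in> {1..n}" "y \<in> {1..n}" "x < y" "(x, y) \<notin> H"
  obtains \<phi> u v where "is_copy m G n (insert (x, y) H) \<phi>" "(u, v) \<in> G" "\<phi> u = x" "\<phi> v = y"
    "degree G u = 1 \<or> x \<in> endpoints H" "degree G v = 1 \<or> y \<in> endpoints H"
proof -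
  obtain \<phi> where new: "is_copy m G n (insert (x, y) H) \<phi>" "\<not> is_copy m G n H \<phi>"
    using assms(2-) unfolding semisaturates_def by blast
  show ?thesis by (rule new_copy_edge[OF assms(1) new]) (rule that[OF new(1)])
qed

section \<open>Linear lower bound when a condition fails\<close>

lemma endpoints_without_first_edge:
  assumes G: "ordered_graph m G" and H: "semisaturates n H m G"
    and no: "\<nexists>v. (1, v) \<in> G \<and> degree G v = 1"
  shows "{2..n} \<subseteq> endpoints H"
proof
  fix y assume y: "y \<in> {2..n}"
  show "y \<in> endpoints H"
  proof (cases "(1, y) \<in> H")
    case True then show ?thesis by (rule endpointsI)
  next
    case False
    have prem: "1 \<in> {1..n}" "y \<in> {1..n}" "1 < y" using y by auto
    obtain \<phi> u v where \<phi>: "is_copy m G n (insert (1, y) H) \<phi>" "(u, v) \<in> G" "\<phi> u = 1"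
      and deg: "degree G v = 1 \<or> y \<in> endpoints H"
      by (rule semisaturates_edge[OF G H prem False]) blast
    \<comment> \<open>A vertex of \<open>G\<close> before \<open>u\<close> would need an image
      before vertex 1.\<close>
    have "u = 1"
    proof (rule ccontr)
      assume "u \<noteq> 1"
      then have "\<phi> 1 < \<phi> u" "\<phi> 1 \<in> {1..n}"
        using ordered_graphD[OF G \<phi>(2)] is_copy_less[OF \<phi>(1)] is_copy_in[OF \<phi>(1)] by auto
      then show False using \<phi>(3) by simp
    qed
    then show ?thesis using deg no \<phi>(2) by blast
  qed
qed

lemma endpoints_without_last_edge:
  assumes G: "ordered_graph m G" and H: "semisaturates n H m G"
    and no: "\<nexists>u. (u, m) \<in> G \<and> degree G u = 1"
  shows "{1..<n} \<subseteq> endpoints H"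
proof
  fix x assume x: "x \<in> {1..<n}"
  show "x \<in> endpoints H"
  proof (cases "(x, n) \<in> H")
    case True then show ?thesis by (rule endpointsI)
  next
    case False
    have prem: "x \<in> {1..n}" "n \<in> {1..n}" "x < n" using x by auto
    obtain \<phi> u v where \<phi>: "is_copy m G n (insert (x, n) H) \<phi>" "(u, v) \<in> G" "\<phi> v = n"
      and deg: "degree G u = 1 \<or> x \<in> endpoints H"
      by (rule semisaturates_edge[OF G H prem False]) blast
    have "v = m"
    proof (rule ccontr)
      assume "v \<noteq> m"
      then have "\<phi> v < \<phi> m" "\<phi> m \<in> {1..n}"
        using ordered_graphD[OF G \<phi>(2)] is_copy_less[OF \<phi>(1)] is_copy_in[OF \<phi>(1)] by auto
      then show False using \<phi>(3) by simp
    qed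
    then show ?thesis using deg no \<phi>(2) by blast
  qed
qed

text \<open>Nothing fits between \<open>x\<close> and \<open>Suc x\<close>, so the edge of
  \<open>G\<close> sent there joins consecutive vertices. As it is no minedge, one of its ends has
  degree other than one.\<close>

lemma endpoints_without_minedge:
  assumes G: "ordered_graph m G" and H: "semisaturates n H m G"
    and no: "\<nexists>e. minedge m G e" and x: "1 \<le> x" "x < n"
  shows "x \<in> endpoints H \<or> Suc x \<in> endpoints H"
proof (cases "(x, Suc x) \<in> H")
  case True then show ?thesis using endpointsI by blast
next
  case False
  have prem: "x \<in> {1..n}" "Suc x \<in> {1..n}" "x < Suc x" using x by auto
  obtain \<phi> u v where \<phi>: "is_copy m G n (insert (x, Suc x) H) \<phi>"
      and uv: "(u, v) \<in> G" "\<phi> u = x" "\<phi> v = Suc x"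
      and deg: "degree G u = 1 \<or> x \<in> endpoints H" "degree G v = 1 \<or> Suc x \<in> endpoints H"
    by (rule semisaturates_edge[OF G H prem False]) blast
  have "False" if "u < w" "w < v" for w
    using that is_copy_less[OF \<phi>, of u w] is_copy_less[OF \<phi>, of w v] uv ordered_graphD[OF G uv(1)]
    by auto
  then have "degree G u \<noteq> 1 \<or> degree G v \<noteq> 1"
    using no uv(1) unfolding minedge_def by fastforce
  then show ?thesis using deg by blast
qed

lemma half_le_endpoints:
  assumes G: "ordered_graph m G" and H: "ordered_graph n H" "semisaturates n H m G"
    and no: "\<not> ((\<exists>e. minedge m G e) \<and> (\<exists>v. (1, v) \<in> G \<and> degree G v = 1) \<and>
      (\<exists>u. (u, m) \<in> G \<and> degree G u = 1))"
  shows "n div 2 \<le> card (endpoints H)"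
proof -
  have fin: "finite (endpoints H)"
    using ordered_graph_finite[OF H(1)] unfolding endpoints_def by simp
  consider "\<nexists>e. minedge m G e" | "\<nexists>v. (1, v) \<in> G \<and> degree G v = 1"
    | "\<nexists>u. (u, m) \<in> G \<and> degree G u = 1"
    using no by blast
  then show ?thesis
  proof cases
    case 1
    \<comment> \<open>The map \<open>(w + 1) div 2\<close> collapses the pair
      \<open>2 * k - 1\<close>, \<open>2 * k\<close> to \<open>k\<close>. These disjoint pairs each
      contain a non-isolated vertex.\<close>
    have "{1..n div 2} \<subseteq> (\<lambda>w. (w + 1) div 2) ` endpoints H"
    proof
      fix k assume k: "k \<in> {1..n div 2}"
      then have "2 * k - 1 \<in> endpoints H \<or> Suc (2 * k - 1) \<in> endpoints H"
        by (intro endpoints_without_minedge[OF G H(2) 1]) auto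
      moreover have "k = (2 * k - 1 + 1) div 2" "k = (Suc (2 * k - 1) + 1) div 2"
        using k by auto
      ultimately show "k \<in> (\<lambda>w. (w + 1) div 2) ` endpoints H" by blast
    qed
    then have "card {1..n div 2} \<le> card (endpoints H)"
      using fin by (meson surj_card_le)
    then show ?thesis by simp
  next
    case 2
    show ?thesis
      using card_mono[OF fin endpoints_without_first_edge[OF G H(2) 2]] by (simp; linarith)
  next
    case 3
    show ?thesis
      using card_mono[OF fin endpoints_without_last_edge[OF G H(2) 3]] by (simp; linarith)
  qed
qed

lemma ssat_ge_linear:
  assumes G: "ordered_graph m G"
    and no: "\<not> ((\<exists>e. minedge m G e) \<and> (\<exists>v. (1, v) \<in> G \<and> degree G v = 1) \<and>
      (\<exists>u. (u, m) \<in> G \<and> degree G u = 1))"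
  shows "n div 2 \<le> 2 * ssat n m G"
proof -
  obtain H where H: "ordered_graph n H" "semisaturates n H m G" "card H = ssat n m G"
    using ssat_attained by blast
  show ?thesis
    using half_le_endpoints[OF G H(1,2) no] card_endpoints_le[OF ordered_graph_finite[OF H(1)]] H(3)
    by linarith
qed

section \<open>Linear upper bound, with tools for both constructions\<close>

lemma ssat_le:
  assumes "ordered_graph n H" "semisaturates n H m G"
  shows "ssat n m G \<le> card H"
  unfolding ssat_def using assms by (intro Least_le) auto

text \<open>The copy is automatically new, because \<open>(a, b)\<close> is sent to the missing edge
  \<open>(x, y)\<close>.\<close>

lemma new_copyI:
  assumes "\<And>i. 1 \<le> i \<Longrightarrow> i \<le> m \<Longrightarrow> 1 \<le> \<phi> i \<and> \<phi> i \<le> n"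
    and "\<And>i j. 1 \<le> i \<Longrightarrow> i < j \<Longrightarrow> j \<le> m \<Longrightarrow> \<phi> i < \<phi> j"
    and "\<And>s t. (s, t) \<in> G \<Longrightarrow> (s, t) \<noteq> (a, b) \<Longrightarrow> (\<phi> s, \<phi> t) \<in> H"
    and "(a, b) \<in> G" "\<phi> a = x" "\<phi> b = y" "(x, y) \<notin> H"
  shows "\<exists>\<phi>. is_copy m G n (insert (x, y) H) \<phi> \<and> \<not> is_copy m G n H \<phi>"
proof (intro exI conjI)
  have "(\<phi> s, \<phi> t) \<in> insert (x, y) H" if "(s, t) \<in> G" for s t
    using assms(3,5,6) that by (cases "(s, t) = (a, b)") auto
  then show "is_copy m G n (insert (x, y) H) \<phi>"
    using assms(1,2) unfolding is_copy_def strict_mono_on_def by auto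
  show "\<not> is_copy m G n H \<phi>"
    using assms(4-7) unfolding is_copy_def by auto
qed

lemma ex_shortest_edge:
  assumes "ordered_graph m G" "G \<noteq> {}"
  obtains a b where "(a, b) \<in> G" "\<And>s t. (s, t) \<in> G \<Longrightarrow> b - a \<le> t - s"
proof -
  obtain e where "e \<in> G" "\<And>e'. e' \<in> G \<Longrightarrow> snd e - fst e \<le> snd e' - fst e'"
    using assms(2) ex_has_least_nat[of "\<lambda>e. e \<in> G" _ "\<lambda>e. snd e - fst e"] by blast
  then show ?thesis using that[of "fst e" "snd e"] by fastforce
qed

text \<open>The condition \<open>n < y + m\<close> places \<open>y\<close> among the last
  \<open>m\<close> vertices without truncated subtraction.\<close>

definition frame :: "nat \<Rightarrow> nat \<Rightarrow> (nat \<times> nat) set" where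
  "frame n m =
    {(x, y). 1 \<le> x \<and> x < y \<and> y \<le> n \<and> (x \<le> m \<or> n < y + m \<or> y \<le> x + m)}"

lemma frameI:
  "1 \<le> x \<Longrightarrow> x < y \<Longrightarrow> y \<le> n \<Longrightarrow> x \<le> m \<or> n < y + m \<Longrightarrow> (x, y) \<in> frame n m"
  unfolding frame_def by blast

lemma card_frame_le: "card (frame n m) \<le> 3 * m * n"
proof -
  let ?A = "{1..m} \<times> {1..n}" and ?B = "{1..n} \<times> {n - m<..n}"
  \<comment> \<open>A short edge is determined by its length \<open>d\<close> and its left end
    \<open>x\<close>. Pairs reaching beyond \<open>n\<close> do no harm in an upper
    estimate.\<close>
  let ?D = "(\<lambda>(d, x). (x, x + d)) ` ({1..m} \<times> {1..n})"
  have sub: "frame n m \<subseteq> ?A \<union> ?B \<union> ?D"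
  proof
    fix e assume e: "e \<in> frame n m"
    obtain x y where xy: "e = (x, y)" by (rule prod.exhaust)
    then have *: "1 \<le> x" "x < y" "y \<le> n" "x \<le> m \<or> n < y + m \<or> y \<le> x + m"
      using e unfolding frame_def by auto
    then consider "x \<le> m" | "n < y + m" | "y \<le> x + m" by blast
    then show "e \<in> ?A \<union> ?B \<union> ?D"
    proof cases
      case 2
      then have "n - m < y" using * by linarith
      then show ?thesis using * xy by simp
    next
      case 3
      then have "(y - x, x) \<in> {1..m} \<times> {1..n}" using * by auto
      moreover have "e = (\<lambda>(d, x). (x, x + d)) (y - x, x)" using * xy by simp
      ultimately show ?thesis by blast
    qed (use * xy in simp_all)
  qed
  have "card ?A = m * n" by simp
  moreover have "card ?B \<le> m * n" by (simp; linarith)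
  moreover have "card ?D \<le> m * n" using card_image_le[of ?A] by simp
  moreover have "card (frame n m) \<le> card (?A \<union> ?B \<union> ?D)" by (rule card_mono[OF _ sub]) simp
  ultimately show ?thesis
    using card_Un_le[of "?A \<union> ?B" ?D] card_Un_le[of ?A ?B] by linarith
qed

lemma frame_semisaturates:
  assumes G: "ordered_graph m G" "G \<noteq> {}"
  shows "semisaturates n (frame n m) m G"
  unfolding semisaturates_def
proof (intro ballI impI, elim conjE)
  fix x y assume xy: "x \<in> {1..n}" "y \<in> {1..n}" "x < y" "(x, y) \<notin> frame n m"
  obtain a b where ab: "(a, b) \<in> G" and short: "\<And>s t. (s, t) \<in> G \<Longrightarrow> b - a \<le> t - s"
    using ex_shortest_edge[OF G] by blast
  have ab': "1 \<le> a" "a < b" "b \<le> m" using ordered_graphD[OF G(1) ab] .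
  have far: "m < x" "y + m \<le> n" "x + m < y" using xy unfolding frame_def by auto
  \<comment> \<open>Writing \<open>d\<close> for \<open>x - a\<close> and \<open>k\<close> for
    \<open>n - m\<close> keeps the later arithmetic free of subtraction.\<close>
  have "x = (x - a) + a" "n = (n - m) + m" using far ab' by auto
  then obtain d k where d: "x = d + a" and k: "n = k + m" by blast
  \<comment> \<open>Vertices before \<open>a\<close> stay at the start and those after
    \<open>b\<close> go to the end. The block from \<open>a\<close> to \<open>b - 1\<close> is
    shifted to begin at \<open>x\<close>; it stays below \<open>y\<close> because
    \<open>x + m < y\<close>.\<close>
  let ?\<phi> = "\<lambda>i. if i < a then i else if i < b then d + i else if i = b then y else k + i"
  show "\<exists>\<phi>. is_copy m G n (insert (x, y) (frame n m)) \<phi> \<and> \<not> is_copy m G n (frame n m) \<phi>"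
  proof (rule new_copyI[where \<phi> = ?\<phi> and a = a and b = b])
    show mono: "?\<phi> i < ?\<phi> j" if "1 \<le> i" "i < j" "j \<le> m" for i j
      using that far ab' unfolding d k by (simp; linarith)
    show bounds: "1 \<le> ?\<phi> i \<and> ?\<phi> i \<le> n" if "1 \<le> i" "i \<le> m" for i
      using that far ab' unfolding d k by (simp; linarith)
    show "(?\<phi> s, ?\<phi> t) \<in> frame n m" if st: "(s, t) \<in> G" "(s, t) \<noteq> (a, b)" for s t
    proof -
      have st': "1 \<le> s" "s < t" "t \<le> m" using ordered_graphD[OF G(1) st(1)] .
      \<comment> \<open>Any other edge inside the interval from \<open>a\<close> to \<open>b\<close>
        would be shorter than \<open>(a, b)\<close>. Hence one end of the image is among the first
        or the last \<open>m\<close> vertices, where every edge is present.\<close>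
      have "s < a \<or> b < t" using short[OF st(1)] st(2) st' by auto
      then have "?\<phi> s \<le> m \<or> n < ?\<phi> t + m" using st' ab' far unfolding d k by (simp; linarith)
      moreover have "1 \<le> s" "s \<le> m" "1 \<le> t" using st' by auto
      ultimately show ?thesis
        using mono[OF st'] bounds[of s] bounds[of t] st'(3) by (intro frameI) blast+
    qed
  qed (use ab ab' xy d in auto)
qed

lemma ssat_le_linear:
  assumes "ordered_graph m G" "G \<noteq> {}"
  shows "ssat n m G \<le> 3 * m * n"
proof -
  have "ordered_graph n (frame n m)" unfolding ordered_graph_def frame_def by auto
  then show ?thesis
    using ssat_le[OF _ frame_semisaturates[OF assms]] card_frame_le le_trans by blast
qed

section \<open>Constant upper bound under the three conditions\<close>

definition clique :: "nat set \<Rightarrow> (nat \<times> nat) set" where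
  "clique C = {(x, y). x \<in> C \<and> y \<in> C \<and> x < y}"

text \<open>Only \<open>a\<close> and \<open>b\<close> may be sent outside \<open>C\<close>, and
  only if of degree one. Such a vertex lies on no edge but \<open>(a, b)\<close>, so all other edges
  land inside the clique.\<close>

lemma clique_new_copyI:
  assumes G: "ordered_graph m G"
    and bounds: "\<And>i. 1 \<le> i \<Longrightarrow> i \<le> m \<Longrightarrow> 1 \<le> \<phi> i \<and> \<phi> i \<le> n"
    and mono: "\<And>i j. 1 \<le> i \<Longrightarrow> i < j \<Longrightarrow> j \<le> m \<Longrightarrow> \<phi> i < \<phi> j"
    and out: "\<And>i. 1 \<le> i \<Longrightarrow> i \<le> m \<Longrightarrow> \<phi> i \<notin> C \<Longrightarrow> (i = a \<or> i = b) \<and> degree G i = 1"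
    and ab: "(a, b) \<in> G" and \<phi>: "\<phi> a = x" "\<phi> b = y" "(x, y) \<notin> clique C"
  shows "\<exists>\<phi>. is_copy m G n (insert (x, y) (clique C)) \<phi> \<and> \<not> is_copy m G n (clique C) \<phi>"
proof (rule new_copyI[OF bounds mono _ ab \<phi>])
  fix s t assume st: "(s, t) \<in> G" "(s, t) \<noteq> (a, b)"
  have st': "1 \<le> s" "s < t" "t \<le> m" using ordered_graphD[OF G st(1)] .
  have "\<phi> w \<in> C" if w: "w = s \<or> w = t" for w
  proof (rule ccontr)
    assume "\<phi> w \<notin> C"
    moreover have "1 \<le> w" "w \<le> m" using w st' by auto
    ultimately have "(w = a \<or> w = b) \<and> degree G w = 1" using out by blast
    then show False using degree_one_unique[OF _ st(1) ab, of w] st(2) w by auto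
  qed
  then show "(\<phi> s, \<phi> t) \<in> clique C"
    using mono[of s t] st' unfolding clique_def by simp
qed

lemma clique_semisaturates:
  assumes G: "ordered_graph m G"
    and pq: "minedge m G (p, q)"
    and v: "(1, v) \<in> G" "degree G v = 1"
    and u: "(u, m) \<in> G" "degree G u = 1"
    and n: "4 * m \<le> n"
  shows "semisaturates n (clique ({1..2 * m} \<union> {n - 2 * m<..n})) m G"
    (is "semisaturates n (clique ?C) m G")
  unfolding semisaturates_def
proof (intro ballI impI, elim conjE)
  fix x y assume xy: "x \<in> {1..n}" "y \<in> {1..n}" "x < y" "(x, y) \<notin> clique ?C"
  have pqG: "(p, q) \<in> G" and deg: "degree G p = 1" "degree G q = 1"
    and gap: "\<And>w. w \<in> {1..m} \<Longrightarrow> p < w \<Longrightarrow> w < q \<Longrightarrow> False"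
    using pq unfolding minedge_def by auto
  have p: "1 \<le> p" "p < q" "q \<le> m" using ordered_graphD[OF G pqG] .
  have q: "q = Suc p" using gap[of "Suc p"] p by fastforce
  have v': "1 < v" "v \<le> m" using ordered_graphD[OF G v(1)] by auto
  have u': "1 \<le> u" "u < m" using ordered_graphD[OF G u(1)] by auto
  have nonedge: "x \<notin> ?C \<or> y \<notin> ?C" using xy unfolding clique_def by auto
  \<comment> \<open>The copy using the minedge fixes the vertices before \<open>p\<close> and sends
    those after \<open>q\<close> to the vertices after \<open>n - m + q\<close>. It fits exactly
    when \<open>p \<le> x\<close> and \<open>y \<le> n - m + q\<close>.\<close>
  consider "x < p" | "n - m + q < y" | "p \<le> x" "y \<le> n - m + q" by linarith
  then show "\<exists>\<phi>. is_copy m G n (insert (x, y) (clique ?C)) \<phi> \<and> \<not> is_copy m G n (clique ?C) \<phi>"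
  proof cases
    case 1
    \<comment> \<open>Here \<open>x < p \<le> m\<close> puts \<open>x\<close> into the clique, so
      \<open>y\<close> lies in the middle. The copy starts at \<open>x\<close>, and
      \<open>x + i - 1 < 2 * m\<close> explains the size \<open>2 * m\<close> of each end; only
      \<open>v\<close> leaves the clique.\<close>
    have y: "2 * m < y" "y + 2 * m \<le> n" using 1 nonedge xy p n by auto
    show ?thesis
      by (rule clique_new_copyI[OF G, where a = 1 and b = v and
            \<phi> = "\<lambda>i. if i < v then x + i - 1 else if i = v then y else n - m + i"])
        (use 1 y xy n p v v' in \<open>auto split: if_splits\<close>)
  next
    case 2
    \<comment> \<open>Mirror image: vertex \<open>m\<close> goes to \<open>y\<close>, and
      \<open>y + i - m\<close> stays above \<open>n - 2 * m\<close>.\<close>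
    have x: "2 * m < x" "x + 2 * m \<le> n" using 2 nonedge xy p n by auto
    show ?thesis
      by (rule clique_new_copyI[OF G, where a = u and b = m and
            \<phi> = "\<lambda>i. if i < u then i else if i = u then x else y + i - m"])
        (use 2 x xy n p u u' in \<open>auto split: if_splits\<close>)
  next
    case 3
    \<comment> \<open>Since \<open>q = Suc p\<close>, no vertex has to be placed between
      \<open>x\<close> and \<open>y\<close>.\<close>
    show ?thesis
      by (rule clique_new_copyI[OF G, where a = p and b = q and
            \<phi> = "\<lambda>i. if i < p then i else if i = p then x else if i = q then y else n - m + i"])
        (use 3 xy n p q deg pqG in \<open>auto split: if_splits\<close>)
  qed
qed

lemma ssat_le_constant:
  assumes "ordered_graph m G" "minedge m G e" "(1, v) \<in> G" "degree G v = 1"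
    "(u, m) \<in> G" "degree G u = 1" "4 * m \<le> n"
  shows "ssat n m G \<le> (4 * m) * (4 * m)"
proof -
  let ?C = "{1..2 * m} \<union> {n - 2 * m<..n}"
  have "ordered_graph n (clique ?C)"
    using assms(7) unfolding ordered_graph_def clique_def by auto
  moreover have "semisaturates n (clique ?C) m G"
    using clique_semisaturates[of m G "fst e" "snd e"] assms by simp
  ultimately have "ssat n m G \<le> card (clique ?C)" by (rule ssat_le)
  also have "\<dots> \<le> card (?C \<times> ?C)"
    by (rule card_mono) (auto simp: clique_def)
  also have "\<dots> = card ?C * card ?C" by (rule card_cartesian_product)
  also have "card ?C \<le> 4 * m"
    using card_Un_le[of "{1..2 * m}" "{n - 2 * m<..n}"] by simp
  then have "card ?C * card ?C \<le> (4 * m) * (4 * m)" by (intro mult_mono) auto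
  finally show ?thesis .
qed

section \<open>Asymptotic dichotomy\<close>

theorem theorem9:
  fixes m :: nat and G :: "(nat \<times> nat) set"
  assumes "ordered_graph m G" and "G \<noteq> {}"
  defines "conds \<equiv>
    (\<exists>e. minedge m G e) \<and>
    (\<exists>v. (1, v) \<in> G \<and> degree G v = 1) \<and>
    (\<exists>u. (u, m) \<in> G \<and> degree G u = 1)"
  shows "((\<lambda>n. real (ssat n m G)) \<in> O(\<lambda>_. 1) \<longleftrightarrow> conds) \<and>
         (\<not> conds \<longrightarrow> (\<lambda>n. real (ssat n m G)) \<in> \<Theta>(\<lambda>n. real n))"
proof -
  have bounded: "(\<lambda>n. real (ssat n m G)) \<in> O(\<lambda>_. 1)" if conds
  proof -
    obtain e u v where "minedge m G e" "(1, v) \<in> G" "degree G v = 1" "(u, m) \<in> G" "degree G u = 1"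
      using \<open>conds\<close> unfolding conds_def by blast
    note le = ssat_le_constant[OF assms(1) this]
    show ?thesis
    proof (rule bigoI[where c = "real ((4 * m) * (4 * m))"])
      show "\<forall>\<^sub>F n in sequentially. norm (real (ssat n m G)) \<le> real ((4 * m) * (4 * m)) * norm (1 :: real)"
        using eventually_ge_at_top[of "4 * m"]
      proof eventually_elim
        case (elim n)
        show ?case using of_nat_mono[OF le[OF elim], where 'a = real] by simp
      qed
    qed
  qed
  have linear: "(\<lambda>n. real (ssat n m G)) \<in> \<Theta>(\<lambda>n. real n)" if no: "\<not> conds"
  proof (rule bigthetaI)
    show "(\<lambda>n. real (ssat n m G)) \<in> O(\<lambda>n. real n)"
    proof (rule bigoI[where c = "real (3 * m)"], intro always_eventually allI)
      fix n
      show "norm (real (ssat n m G)) \<le> real (3 * m) * norm (real n)"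
        using of_nat_mono[OF ssat_le_linear[OF assms(1,2), of n], where 'a = real] by simp
    qed
    \<comment> \<open>The bound gives \<open>n \<le> 4 * ssat n m G + 1\<close>. For
      \<open>2 \<le> n\<close> it also makes \<open>ssat n m G\<close> positive, which absorbs the
      1.\<close>
    have "real n \<le> 8 * real (ssat n m G)" if "2 \<le> n" for n
      using ssat_ge_linear[OF assms(1) no[unfolded conds_def], of n] that by linarith
    then have "(\<lambda>n. real n) \<in> O(\<lambda>n. real (ssat n m G))"
      by (intro bigoI[where c = 8] eventually_mono[OF eventually_ge_at_top[of 2]]) auto
    then show "(\<lambda>n. real (ssat n m G)) \<in> \<Omega>(\<lambda>n. real n)"
      by (simp add: bigomega_iff_bigo)
  qed
  have "conds" if O1: "(\<lambda>n. real (ssat n m G)) \<in> O(\<lambda>_. 1)"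
  proof (rule ccontr)
    assume "\<not> conds"
    then have "(\<lambda>n. real n) \<in> O(\<lambda>_. 1)"
      using linear O1 by (meson bigthetaD2 bigomega_iff_bigo landau_o.big_trans)
    then obtain c where "eventually (\<lambda>n. norm (real n) \<le> c * norm (1 :: real)) sequentially"
      by (elim landau_o.bigE)
    moreover have "eventually (\<lambda>n. c < real n) sequentially"
      using filterlim_real_sequentially unfolding filterlim_at_top_dense by blast
    ultimately have "eventually (\<lambda>n::nat. False) sequentially"
      by eventually_elim simp
    then show False by simp
  qed
  then show ?thesis using bounded linear by blast
qed

end
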